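(* Any distributive $\langle\vee,0\rangle$-semilattice is the range of some V-distance of type $2$; that is, for every distributive $\langle\vee,0\rangle$-semilattice $S$ there are a set $X$ and a surjective $S$-valued V-distance $\delta\colon X\times X\to S$ of type $2$.
   Context: A $\langle\vee,0\rangle$-semilattice $S$ is distributive if for all $a,b,c\in S$ with $c\leq a\vee b$ there are $a'\leq a$ and $b'\leq b$ in $S$ such that $c=a'\vee b'$. Let $S$ be a $\langle\vee,0\rangle$-semilattice and $X$ a set. A map $\delta\colon X\times X\to S$ is an $S$-valued distance on $X$ if $\delta(x,x)=0$, $\delta(x,y)=\delta(y,x)$, and $\delta(x,z)\leq\delta(x,y)\vee\delta(y,z)$ for all $x,y,z\in X$. For a positive integer $n$, such a $\delta$ is a V-distance of type $n$ if for all $x,y\in X$ and all $a,b\in S$ such that $\delta(x,y)\leq a\vee b$, there are $z_0=x,z_1,\dots,z_{n+1}=y$ in $X$ such that for all $i\leq n$, $\delta(z_i,z_{i+1})\leq a$ if $i$ is even, and $\delta(z_i,z_{i+1})\leq b$ if $i$ is odd. *)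

theory Defs
  imports Main
begin

class distributive_semilattice_sup_bot = bounded_semilattice_sup_bot +
  assumes sup_refinement:
    "c \<le> sup a b \<Longrightarrow> \<exists>a' b'. a' \<le> a \<and> b' \<le> b \<and> c = sup a' b'"

text \<open>A map from \<open>X \<times> X\<close> to the semilattice is represented by a curried total function,
  whose values outside the carrier \<open>X\<close> are irrelevant.\<close>

definition semilattice_distance ::
  "'x set \<Rightarrow> ('x \<Rightarrow> 'x \<Rightarrow> 'a::bounded_semilattice_sup_bot) \<Rightarrow> bool" where
  "semilattice_distance X \<delta> \<longleftrightarrow>
    (\<forall>x\<in>X. \<delta> x x = bot) \<and>
    (\<forall>x\<in>X. \<forall>y\<in>X. \<delta> x y = \<delta> y x) \<and>
    (\<forall>x\<in>X. \<forall>y\<in>X. \<forall>z\<in>X. \<delta> x z \<le> sup (\<delta> x y) (\<delta> y z))"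

definition V_distance ::
  "nat \<Rightarrow> 'x set \<Rightarrow> ('x \<Rightarrow> 'x \<Rightarrow> 'a::bounded_semilattice_sup_bot) \<Rightarrow> bool" where
  "V_distance n X \<delta> \<longleftrightarrow>
    n > 0 \<and> semilattice_distance X \<delta> \<and>
    (\<forall>x\<in>X. \<forall>y\<in>X. \<forall>a b. \<delta> x y \<le> sup a b \<longrightarrow>
      (\<exists>z::nat \<Rightarrow> 'x. z 0 = x \<and> z (n + 1) = y \<and> (\<forall>i\<le>n + 1. z i \<in> X) \<and>
        (\<forall>i\<le>n. (even i \<longrightarrow> \<delta> (z i) (z (i + 1)) \<le> a) \<and>
               (odd i \<longrightarrow> \<delta> (z i) (z (i + 1)) \<le> b))))"

text \<open>HOL cannot quantify existentially over types, so "there is a set \<open>X\<close> with a surjective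
  V-distance to \<open>'a\<close>" is expressed with \<open>X :: 'a list set\<close>. This loses no generality: given such a
  distance on any set, choose a pair of points for every value and close the resulting set under
  witnesses \<open>z\<close>; the subset obtained is at most as large as \<open>'a\<close> or countable, hence embeds into
  the infinite type \<open>'a list\<close>.\<close>

end

theory Submission
  imports Defs
begin

text \<open>
  A single instance of the type 2 condition is repaired by adjoining two points. Suppose
  \<open>\<delta> x y \<le> a \<squnion> b\<close>. Distributivity replaces \<open>a\<close> and \<open>b\<close> by smaller elements for which
  \<open>\<delta> x y = a \<squnion> b\<close> holds with equality, and then one adjoins \<open>u\<close> and \<open>v\<close> with

    \<open>\<delta> x u = a\<close>, \<open>\<delta> u v = b\<close>, \<open>\<delta> v y = a\<close>,

  where \<open>u\<close> is otherwise reached only through \<open>x\<close> (so \<open>\<delta> w u = \<delta> w x \<squnion> a\<close>) and \<open>v\<close> only through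
  \<open>y\<close>. The shortcut from \<open>u\<close> to \<open>v\<close> is harmless because of the equality: \<open>b \<le> \<delta> x y\<close>
  says that it is at most the old route through \<open>x\<close> and \<open>y\<close>, and \<open>\<delta> x y \<le> a \<squnion> b\<close> says that
  taking it, at the additional cost \<open>a\<close> paid at either end, still bounds \<open>\<delta> x y\<close>.

  The proof performs all these extensions at once, stage by stage, starting from the distance
  \<open>s \<squnion> t\<close> (for \<open>s \<noteq> t\<close>) on the semilattice itself, which already takes every value because
  \<open>\<delta> s \<bottom> = s\<close>. The points are formal terms: \<open>Adjoin x y a b\<close> is the \<open>u\<close> above, and the \<open>v\<close> above is
  \<open>Adjoin y x a b\<close>, so one constructor provides both. The depth of a term is the stage at which
  it is adjoined, and the triangle inequality is proved by induction on the stage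
  (\<open>dist_triangle\<close>). Finally the terms are written as lists by a prefix code.
\<close>

section \<open>Formal points and their distance\<close>

datatype 'a point = Base 'a | Adjoin "'a point" "'a point" 'a 'a

primrec depth :: "'a point \<Rightarrow> nat" where
  "depth (Base s) = 0"
| "depth (Adjoin x y a b) = Suc (max (depth x) (depth y))"

text \<open>The two points adjoined for one instance of the type 2 condition.\<close>

fun twins :: "'a point \<Rightarrow> 'a point \<Rightarrow> bool" where
  "twins (Adjoin x y a b) (Adjoin x' y' a' b') \<longleftrightarrow> x' = y \<and> y' = x \<and> a' = a \<and> b' = b"
| "twins _ _ \<longleftrightarrow> False"

text \<open>Comparing depths decides which of the two points is the newer one; only a newer point may be
  replaced by the point to which it is attached, since the other one had to be present when its
  distances were fixed. Points of the same stage that are not twins are both replaced.\<close>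

fun dist :: "'a::bounded_semilattice_sup_bot point \<Rightarrow> 'a point \<Rightarrow> 'a" where
  "dist (Base s) (Base t) = (if s = t then bot else sup s t)"
| "dist (Base s) (Adjoin x y a b) = sup a (dist (Base s) x)"
| "dist (Adjoin x y a b) (Base s) = sup a (dist x (Base s))"
| "dist (Adjoin x y a b) (Adjoin x' y' a' b') =
    (if Adjoin x y a b = Adjoin x' y' a' b' then bot
     else if twins (Adjoin x y a b) (Adjoin x' y' a' b') then b
     else if depth (Adjoin x y a b) < depth (Adjoin x' y' a' b')
       then sup a' (dist (Adjoin x y a b) x')
     else if depth (Adjoin x' y' a' b') < depth (Adjoin x y a b)
       then sup a (dist x (Adjoin x' y' a' b'))
     else sup (sup a a') (dist x x'))"

inductive_set points :: "'a::bounded_semilattice_sup_bot point set" where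
  Base: "Base s \<in> points"
| Adjoin: "x \<in> points \<Longrightarrow> y \<in> points \<Longrightarrow> dist x y = sup a b \<Longrightarrow> Adjoin x y a b \<in> points"

lemma twins_depth: "twins p q \<Longrightarrow> depth p = depth q"
  by (cases "(p, q)" rule: twins.cases) auto

lemma twins_sym: "twins p q \<longleftrightarrow> twins q p"
  by (cases "(p, q)" rule: twins.cases; cases q) auto

lemma dist_refl [simp]: "dist p p = bot"
  by (cases p) auto

lemma dist_commute: "dist p q = dist q p"
proof (induction p q rule: dist.induct)
  case (4 x y a b x' y' a' b')
  let ?p = "Adjoin x y a b" and ?q = "Adjoin x' y' a' b'"
  consider "?p = ?q" | "?p \<noteq> ?q" "twins ?p ?q"
    | "?p \<noteq> ?q" "\<not> twins ?p ?q" "depth ?p < depth ?q"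
    | "?p \<noteq> ?q" "\<not> twins ?p ?q" "depth ?q < depth ?p"
    | "?p \<noteq> ?q" "\<not> twins ?p ?q" "depth ?p = depth ?q"
    by linarith
  then show ?case
  proof cases
    case 1
    then show ?thesis by (simp only:)
  next
    case 2
    then show ?thesis by simp
  next
    case 3
    with "4.IH"(1) have "dist ?p x' = dist x' ?p" by blast
    with 3 3(1)[symmetric] show ?thesis
      using twins_sym[of ?p ?q] by (simp only: dist.simps if_False if_True less_not_sym)
  next
    case 4
    then have "\<not> depth ?p < depth ?q" by linarith
    with 4 "4.IH"(2) have "dist x ?q = dist ?q x" by blast
    with 4 4(1)[symmetric] show ?thesis
      using twins_sym[of ?p ?q] by (simp only: dist.simps if_False if_True less_not_sym)
  next
    case 5
    then have "\<not> depth ?p < depth ?q" "\<not> depth ?q < depth ?p" by linarith+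
    with 5 "4.IH"(3) have "dist x x' = dist x' x" by blast
    with 5 5(1)[symmetric] show ?thesis
      using twins_sym[of ?p ?q] by (simp only: dist.simps if_False less_irrefl sup_commute)
  qed
qed (simp_all add: sup_commute eq_commute)

lemma dist_newer:
  assumes "depth q < depth (Adjoin x y a b)"
  shows "dist q (Adjoin x y a b) = sup a (dist q x)"
proof (cases q)
  case (Adjoin x' y' a' b')
  have "q \<noteq> Adjoin x y a b" "\<not> twins q (Adjoin x y a b)"
    using assms twins_depth by fastforce+
  then show ?thesis
    using assms by (simp only: Adjoin dist.simps if_False if_True)
qed simp

section \<open>One stage of the extension\<close>

text \<open>For a point of stage at most \<open>n + 1\<close>, its anchor is the point of stage at most \<open>n\<close> through
  which it is reached, and its height is the cost of getting there. Old points are their own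
  anchors, so the distance formula below covers old and new points uniformly.\<close>

definition anchor :: "nat \<Rightarrow> 'a point \<Rightarrow> 'a point" where
  "anchor n p = (case p of Base _ \<Rightarrow> p | Adjoin x _ _ _ \<Rightarrow> if depth p \<le> n then p else x)"

definition height :: "nat \<Rightarrow> 'a::bounded_semilattice_sup_bot point \<Rightarrow> 'a" where
  "height n p = (case p of Base _ \<Rightarrow> bot | Adjoin _ _ a _ \<Rightarrow> if depth p \<le> n then bot else a)"

definition via_anchors :: "nat \<Rightarrow> 'a::bounded_semilattice_sup_bot point \<Rightarrow> 'a point \<Rightarrow> 'a" where
  "via_anchors n p q = sup (sup (height n p) (height n q)) (dist (anchor n p) (anchor n q))"

lemma anchor_height_old:
  "depth p \<le> n \<Longrightarrow> anchor n p = p" "depth p \<le> n \<Longrightarrow> height n p = bot"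
  by (auto simp: anchor_def height_def split: point.splits)

lemma anchor_height_new:
  "depth (Adjoin x y a b) = Suc n \<Longrightarrow> anchor n (Adjoin x y a b) = x"
  "depth (Adjoin x y a b) = Suc n \<Longrightarrow> height n (Adjoin x y a b) = a"
  by (auto simp: anchor_def height_def)

lemma anchor_in_points: "p \<in> points \<Longrightarrow> anchor n p \<in> points"
  by (cases rule: points.cases) (auto simp: anchor_def intro: points.intros)

lemma depth_anchor: "depth p \<le> Suc n \<Longrightarrow> depth (anchor n p) \<le> n"
  by (cases p) (auto simp: anchor_def)

lemma dist_eq_via_anchors:
  assumes "depth p \<le> Suc n" "depth q \<le> Suc n" "p \<noteq> q" "\<not> (twins p q \<and> depth p = Suc n)"
  shows "dist p q = via_anchors n p q"
proof -
  have one_new: "dist p q = via_anchors n p q"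
    if p: "depth p \<le> n" and q: "depth q = Suc n" for p q :: "'a point"
  proof -
    from q obtain x y a b where q_eq: "q = Adjoin x y a b"
      by (cases q) auto
    show ?thesis
      using dist_newer[of p x y a b] p q
      by (simp add: via_anchors_def anchor_height_old anchor_height_new q_eq del: depth.simps)
  qed
  consider "depth p \<le> n" "depth q \<le> n" | "depth p \<le> n" "depth q = Suc n"
    | "depth p = Suc n" "depth q \<le> n" | "depth p = Suc n" "depth q = Suc n"
    using assms by linarith
  then show ?thesis
  proof cases
    case 1
    then show ?thesis by (simp add: via_anchors_def anchor_height_old)
  next
    case 2
    then show ?thesis by (rule one_new)
  next
    case 3
    have "via_anchors n p q = via_anchors n q p"
      by (simp add: via_anchors_def dist_commute sup_commute)
    with one_new[of q p] 3 show ?thesis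
      by (simp add: dist_commute)
  next
    case 4
    then obtain x y a b x' y' a' b' where eqs: "p = Adjoin x y a b" "q = Adjoin x' y' a' b'"
      by (cases p; cases q) auto
    have "\<not> twins p q"
      using assms(4) 4 by simp
    with 4 assms(3) show ?thesis
      unfolding via_anchors_def eqs
      by (simp only: anchor_height_new dist.simps if_False less_irrefl)
  qed
qed

text \<open>The defining condition \<open>dist x y = sup a b\<close> of an adjoined pair, in the two directions in which
  it is used: the shortcut between twins is at most the route through their anchors, and together
  with one height it bounds the distance of the anchors.\<close>

lemma twins_at_new_stage:
  assumes "twins p q" "p \<in> points" "depth p = Suc n"
  shows "height n q = height n p"
    and "dist p q \<le> via_anchors n p q"
    and "dist (anchor n p) (anchor n q) \<le> sup (height n p) (dist p q)"
proof -
  obtain x y a b where p: "p = Adjoin x y a b" and q: "q = Adjoin y x a b"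
    using assms(1) by (cases "(p, q)" rule: twins.cases) auto
  have d: "dist x y = sup a b"
    using assms(2) unfolding p by (cases rule: points.cases) auto
  have n: "depth (Adjoin x y a b) = Suc n" "depth (Adjoin y x a b) = Suc n"
    using assms(3) by (simp_all add: p max.commute)
  note new = n[THEN anchor_height_new(1)] n[THEN anchor_height_new(2)]
  show "height n q = height n p"
    by (simp only: p q new)
  show "dist p q \<le> via_anchors n p q"
    unfolding via_anchors_def p q new d by (simp add: le_supI2)
  \<comment> \<open>The twins coincide when \<open>x = y\<close>; then the distance of the anchors is \<open>bot\<close>.\<close>
  show "dist (anchor n p) (anchor n q) \<le> sup (height n p) (dist p q)"
  proof (cases "x = y")
    case True
    then show ?thesis unfolding p q new by simp
  next
    case False
    then show ?thesis unfolding p q new d by simp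
  qed
qed

text \<open>If the distances \<open>p q\<close> and \<open>q r\<close> are both measured through the anchors, the
  inequality is inherited from the stage before. The only other case of interest is a shortcut between
  twins followed by a route through anchors: then \<open>p\<close> and \<open>q\<close> have the same height, which is
  contained in the second distance, and the shortcut together with this height bounds the distance
  of the anchors of \<open>p\<close> and \<open>q\<close>.\<close>

theorem dist_triangle:
  fixes p q r :: "'a::bounded_semilattice_sup_bot point"
  assumes "p \<in> points" "q \<in> points" "r \<in> points"
  shows "dist p r \<le> sup (dist p q) (dist q r)"
proof -
  have at_stage: "dist p r \<le> sup (dist p q) (dist q r)"
    if "depth p \<le> n" "depth q \<le> n" "depth r \<le> n" "p \<in> points" "q \<in> points" "r \<in> points"
    for n and p q r :: "'a point"
    using that
  proof (induction n arbitrary: p q r)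
    case 0
    then obtain s t u where "p = Base s" "q = Base t" "r = Base u"
      by (cases p; cases q; cases r) auto
    then show ?case
      by (simp add: le_supI1 le_supI2)
  next
    case (Suc n)
    let ?shortcut = "\<lambda>p q :: 'a point. twins p q \<and> depth p = Suc n"
    let ?d = "via_anchors n" and ?h = "height n" and ?\<pi> = "anchor n"
    have base: "dist (?\<pi> p) (?\<pi> r) \<le> sup (dist (?\<pi> p) (?\<pi> q)) (dist (?\<pi> q) (?\<pi> r))"
      if "depth p \<le> Suc n" "depth q \<le> Suc n" "depth r \<le> Suc n"
        "p \<in> points" "q \<in> points" "r \<in> points" for p q r :: "'a point"
      using Suc.IH that by (simp add: depth_anchor anchor_in_points)
    have upper: "dist p q \<le> ?d p q"
      if "depth p \<le> Suc n" "depth q \<le> Suc n" "p \<in> points" "q \<in> points" for p q :: "'a point"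
      using that twins_at_new_stage(2)[of p q n] dist_eq_via_anchors[of p n q] by fastforce
    have detour: "dist p r \<le> sup (dist p q) (dist q r)"
      if sc: "?shortcut p q" and nsc: "\<not> ?shortcut q r" and "q \<noteq> r"
        and dp: "depth p \<le> Suc n" "depth q \<le> Suc n" "depth r \<le> Suc n"
        and pt: "p \<in> points" "q \<in> points" "r \<in> points" for p q r :: "'a point"
    proof -
      have qr: "dist q r = ?d q r"
        using dist_eq_via_anchors dp nsc \<open>q \<noteq> r\<close> by blast
      have h: "?h q = ?h p"
        and pq: "dist (?\<pi> p) (?\<pi> q) \<le> sup (?h p) (dist p q)"
        using twins_at_new_stage[of p q n] sc pt by auto
      have "dist (?\<pi> p) (?\<pi> r) \<le> sup (sup (?h p) (dist p q)) (dist (?\<pi> q) (?\<pi> r))"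
        using base[OF dp pt] pq by (meson order_trans order_refl sup_mono)
      also have "\<dots> \<le> sup (dist p q) (?d q r)"
        unfolding via_anchors_def h by (simp add: le_supI1 le_supI2)
      finally have "?d p r \<le> sup (dist p q) (?d q r)"
        unfolding via_anchors_def h by (simp add: le_supI1 le_supI2)
      with upper[of p r] dp pt qr show ?thesis
        by (metis order_trans)
    qed
    consider "p = q \<or> q = r" | "?shortcut p q" "?shortcut q r"
      | "?shortcut p q" "\<not> ?shortcut q r" "q \<noteq> r"
      | "\<not> ?shortcut p q" "?shortcut q r" "p \<noteq> q"
      | "\<not> ?shortcut p q" "\<not> ?shortcut q r" "p \<noteq> q" "q \<noteq> r"
      by blast
    then show ?case
    proof cases
      case 1
      then show ?thesis by auto
    next
      case 2
      then have "p = r"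
        by (cases "(p, q)" rule: twins.cases; cases r) auto
      then show ?thesis by simp
    next
      case 3
      then show ?thesis using detour Suc.prems by blast
    next
      case 4
      have "?shortcut r q" "\<not> ?shortcut q p"
        using 4 twins_sym twins_depth by metis+
      with 4 detour[of r q p] Suc.prems have "dist r p \<le> sup (dist r q) (dist q p)"
        by auto
      then show ?thesis
        by (metis dist_commute sup_commute)
    next
      case 5
      then have "dist p q = ?d p q" "dist q r = ?d q r"
        using dist_eq_via_anchors Suc.prems by blast+
      moreover have "?d p r \<le> sup (?d p q) (?d q r)"
      proof -
        have "dist (?\<pi> p) (?\<pi> r) \<le> sup (dist (?\<pi> p) (?\<pi> q)) (dist (?\<pi> q) (?\<pi> r))"
          using base Suc.prems by blast
        also have "\<dots> \<le> sup (?d p q) (?d q r)"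
          unfolding via_anchors_def by (simp add: le_supI1 le_supI2)
        finally show ?thesis
          unfolding via_anchors_def by (simp add: le_supI1 le_supI2)
      qed
      ultimately show ?thesis
        using upper[of p r] Suc.prems by (metis order_trans)
    qed
  qed
  show ?thesis
    by (rule at_stage[of _ "max (depth p) (max (depth q) (depth r))"]) (use assms in simp_all)
qed

section \<open>The type 2 condition and surjectivity\<close>

lemma V_distance_points:
  "V_distance 2 (points :: 'a::distributive_semilattice_sup_bot point set) dist"
  unfolding V_distance_def semilattice_distance_def
proof (intro conjI ballI allI impI)
  fix x y :: "'a point" and a b :: 'a
  assume xy: "x \<in> points" "y \<in> points" and "dist x y \<le> sup a b"
  then obtain a' b' where ab: "a' \<le> a" "b' \<le> b" "dist x y = sup a' b'"
    using sup_refinement by blast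
  define u v where "u = Adjoin x y a' b'" and "v = Adjoin y x a' b'"
  define z :: "nat \<Rightarrow> 'a point" where
    "z i = (if i = 0 then x else if i = 1 then u else if i = 2 then v else y)" for i
  have uv: "u \<in> points" "v \<in> points"
    using xy ab dist_commute[of x y] unfolding u_def v_def by (auto intro: points.Adjoin)
  have "dist x u = a'" "dist y v = a'"
    unfolding u_def v_def by (simp_all add: dist_newer del: dist.simps)
  moreover have "dist u v \<le> b'"
    unfolding u_def v_def by simp
  ultimately have steps: "dist x u \<le> a" "dist u v \<le> b" "dist v y \<le> a"
    using ab dist_commute[of v y] by auto
  show "\<exists>z. z 0 = x \<and> z (2 + 1) = y \<and> (\<forall>i\<le>2 + 1::nat. z i \<in> points) \<and>
      (\<forall>i\<le>2::nat. (even i \<longrightarrow> dist (z i) (z (i + 1)) \<le> a) \<and>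
              (odd i \<longrightarrow> dist (z i) (z (i + 1)) \<le> b))"
  proof (rule exI[of _ z], intro conjI allI impI)
    fix i :: nat
    assume "i \<le> 2"
    then have "i = 0 \<or> i = 1 \<or> i = 2" by auto
    then show "even i \<Longrightarrow> dist (z i) (z (i + 1)) \<le> a" "odd i \<Longrightarrow> dist (z i) (z (i + 1)) \<le> b"
      using steps by (auto simp: z_def)
  qed (use xy uv in \<open>auto simp: z_def\<close>)
qed (auto intro: dist_commute dist_triangle)

lemma dist_surj:
  "(\<lambda>(x, y). dist x y) ` (points \<times> points) = (UNIV :: 'a::bounded_semilattice_sup_bot set)"
proof -
  have "s \<in> (\<lambda>(x, y). dist x y) ` (points \<times> points)" for s :: 'a
    by (rule image_eqI[of _ _ "(Base s, Base bot)"]) (auto intro: points.Base)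
  then show ?thesis by blast
qed

section \<open>Points as lists\<close>

text \<open>Preorder traversal, with the entries \<open>bot\<close> and \<open>t\<close> marking the constructors. Since each
  constructor has a fixed number of arguments, this is a prefix code once \<open>t \<noteq> bot\<close>.\<close>

primrec encode :: "'a::bounded_semilattice_sup_bot \<Rightarrow> 'a point \<Rightarrow> 'a list" where
  "encode t (Base s) = [bot, s]"
| "encode t (Adjoin x y a b) = [t, a, b] @ encode t x @ encode t y"

lemma encode_prefix_code:
  assumes "t \<noteq> bot" "encode t p @ us = encode t q @ vs"
  shows "p = q \<and> us = vs"
  using assms(2)
proof (induction p arbitrary: q us vs)
  case (Base s)
  then show ?case using assms(1) by (cases q) auto
next
  case (Adjoin x y a b)
  from Adjoin.prems obtain x' y' where q: "q = Adjoin x' y' a b"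
    and eq: "encode t x @ encode t y @ us = encode t x' @ encode t y' @ vs"
    using assms(1) by (cases q) auto
  from Adjoin.IH(1)[OF eq] have "x = x'" "encode t y @ us = encode t y' @ vs"
    by auto
  with Adjoin.IH(2) q show ?case by metis
qed

lemma inj_encode: "t \<noteq> bot \<Longrightarrow> inj (encode t)"
  by (rule injI) (metis append_Nil2 encode_prefix_code)

lemma V_distance_transport:
  assumes "inj e" "V_distance n X \<delta>"
  shows "V_distance n (e ` X) (\<lambda>u v. \<delta> (inv e u) (inv e v))"
  unfolding V_distance_def
proof (intro conjI ballI allI impI)
  show "n > 0" using assms(2) by (simp add: V_distance_def)
  show "semilattice_distance (e ` X) (\<lambda>u v. \<delta> (inv e u) (inv e v))"
    using assms by (auto simp: V_distance_def semilattice_distance_def)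
next
  fix u v a b
  assume "u \<in> e ` X" "v \<in> e ` X" and le: "\<delta> (inv e u) (inv e v) \<le> sup a b"
  then obtain x y where xy: "x \<in> X" "u = e x" "y \<in> X" "v = e y" by blast
  with le assms obtain z where "z 0 = x" "z (n + 1) = y" "\<forall>i\<le>n + 1. z i \<in> X"
    "\<forall>i\<le>n. (even i \<longrightarrow> \<delta> (z i) (z (i + 1)) \<le> a) \<and> (odd i \<longrightarrow> \<delta> (z i) (z (i + 1)) \<le> b)"
    unfolding V_distance_def by (metis inv_f_f)
  with xy assms(1)
  show "\<exists>z. z 0 = u \<and> z (n + 1) = v \<and> (\<forall>i\<le>n + 1. z i \<in> e ` X) \<and>
      (\<forall>i\<le>n. (even i \<longrightarrow> \<delta> (inv e (z i)) (inv e (z (i + 1))) \<le> a) \<and>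
              (odd i \<longrightarrow> \<delta> (inv e (z i)) (inv e (z (i + 1))) \<le> b))"
    by (intro exI[of _ "e \<circ> z"]) auto
qed

theorem proposition2p6:
  "\<exists>(X :: 'a::distributive_semilattice_sup_bot list set) (\<delta> :: 'a list \<Rightarrow> 'a list \<Rightarrow> 'a).
     V_distance 2 X \<delta> \<and> (\<lambda>(x, y). \<delta> x y) ` (X \<times> X) = UNIV"
proof (cases "\<exists>t::'a. t \<noteq> bot")
  case True
  then obtain t :: 'a where "t \<noteq> bot" by blast
  then have inj: "inj (encode t)" by (rule inj_encode)
  let ?X = "encode t ` points" and ?\<delta> = "\<lambda>u v. dist (inv (encode t) u) (inv (encode t) v)"
  have "s \<in> (\<lambda>(u, v). ?\<delta> u v) ` (?X \<times> ?X)" for s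
  proof -
    have "s \<in> (\<lambda>(x, y). dist x y) ` (points \<times> points)"
      by (simp add: dist_surj)
    then obtain x y where "x \<in> points" "y \<in> points" "dist x y = s"
      by auto
    then show ?thesis
      using inj by (intro image_eqI[of _ _ "(encode t x, encode t y)"]) auto
  qed
  then have "(\<lambda>(u, v). ?\<delta> u v) ` (?X \<times> ?X) = UNIV" by blast
  with V_distance_transport[OF inj V_distance_points] show ?thesis by blast
next
  \<comment> \<open>In the one-element semilattice no entry can mark the constructors, but one point is enough.\<close>
  case False
  then have eq: "s = bot" for s :: 'a by blast
  have "V_distance 2 {[] :: 'a list} (\<lambda>_ _. bot :: 'a)"
    unfolding V_distance_def semilattice_distance_def
    by (intro conjI ballI allI impI exI[of _ "\<lambda>_. []"]) simp_all
  moreover have "(\<lambda>(x, y). bot :: 'a) ` ({[] :: 'a list} \<times> {[]}) = UNIV"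
    using eq by auto
  ultimately show ?thesis by blast
qed

end
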